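(* Let $n,m\ge 2$ be integers. If $n=3t+1$ and $m=3r+1$ for some nonnegative integers $t,r$, then $$2\le b(P_n\boxtimes P_m)\le 5.$$
   Context: All graphs are finite, simple and undirected. $P_k$ denotes the path with $k$ vertices. The strong product $G\boxtimes H$ of graphs $G$ and $H$ has vertex set $V(G)\times V(H)$, and two vertices $(v,u)$ and $(v',u')$ are adjacent if and only if ($v=v'$ and $u\sim u'$), or ($v\sim v'$ and $u=u'$), or ($v\sim v'$ and $u\sim u'$), where $\sim$ denotes adjacency. A set $D$ of vertices of $G$ is dominating if every vertex of $G$ is in $D$ or adjacent to a vertex of $D$; the domination number $\gamma(G)$ is the minimum cardinality of a dominating set. For a graph $G$ with nonempty edge set $E$, the bondage number $b(G)$ is the minimum cardinality of a set $E'\subseteq E$ such that $\gamma(G-E')>\gamma(G)$, where $G-E'$ is obtained from $G$ by deleting the edges of $E'$ and keeping all vertices. *)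

theory Defs
  imports Main
begin

text \<open>
  Undirected graphs carry their edges as two-element vertex sets, so that the cardinality of a
  set of edges counts undirected edges. (Modelling graphs as symmetric digraphs would count each
  edge twice, which matters for the bondage number.)
\<close>

record 'a graph =
  verts :: "'a set"
  edges :: "'a set set"

locale simple_graph =
  fixes G :: "'a graph"
  assumes finite_verts: "finite (verts G)"
    and edges_wf: "e \<in> edges G \<Longrightarrow> e \<subseteq> verts G \<and> card e = 2"

definition adj :: "'a graph \<Rightarrow> 'a \<Rightarrow> 'a \<Rightarrow> bool" where
  "adj G u v \<longleftrightarrow> {u, v} \<in> edges G"

definition path_graph :: "nat \<Rightarrow> nat graph" where
  "path_graph k = \<lparr>verts = {..<k}, edges = {{i, Suc i} | i. Suc i < k}\<rparr>"

definition strong_product :: "'a graph \<Rightarrow> 'b graph \<Rightarrow> ('a \<times> 'b) graph" (infixl \<open>\<boxtimes>\<close> 70) where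
  "G \<boxtimes> H = \<lparr>verts = verts G \<times> verts H,
     edges = {{(v, u), (v', u')} | v u v' u'.
       (v, u) \<in> verts G \<times> verts H \<and> (v', u') \<in> verts G \<times> verts H \<and>
       ((v = v' \<and> adj H u u') \<or> (adj G v v' \<and> u = u') \<or> (adj G v v' \<and> adj H u u'))}\<rparr>"

definition dominating_set :: "'a graph \<Rightarrow> 'a set \<Rightarrow> bool" where
  "dominating_set G D \<longleftrightarrow>
     D \<subseteq> verts G \<and> (\<forall>v \<in> verts G. v \<in> D \<or> (\<exists>u \<in> D. adj G v u))"

definition domination_number :: "'a graph \<Rightarrow> nat" where
  "domination_number G = (LEAST k. \<exists>D. dominating_set G D \<and> card D = k)"

definition delete_edges :: "'a graph \<Rightarrow> 'a set set \<Rightarrow> 'a graph" where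
  "delete_edges G F = \<lparr>verts = verts G, edges = edges G - F\<rparr>"

text \<open>Meaningful for simple graphs with at least one edge; see \<open>bondage_number_attained\<close> below.\<close>

definition bondage_number :: "'a graph \<Rightarrow> nat" where
  "bondage_number G = (LEAST k. \<exists>F. F \<subseteq> edges G \<and> card F = k \<and>
     domination_number (delete_edges G F) > domination_number G)"

lemma simple_graph_path_graph: "simple_graph (path_graph k)"
  by unfold_locales (auto simp: path_graph_def)

lemma path_graph_edges_nonempty: "k \<ge> 2 \<Longrightarrow> edges (path_graph k) \<noteq> {}"
  by (auto simp: path_graph_def intro: exI[of _ 0])

context simple_graph
begin

lemma adj_irrefl: "\<not> adj G v v"
  using edges_wf[of "{v, v}"] by (auto simp: adj_def)

lemma adj_sym: "adj G u v \<longleftrightarrow> adj G v u"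
  by (simp add: adj_def insert_commute)

lemma adj_verts: "adj G u v \<Longrightarrow> u \<in> verts G \<and> v \<in> verts G"
  using edges_wf[of "{u, v}"] by (auto simp: adj_def)

end

lemma adj_strong_product:
  assumes "simple_graph G" "simple_graph H"
    and "(v, u) \<in> verts (G \<boxtimes> H)" "(v', u') \<in> verts (G \<boxtimes> H)"
  shows "adj (G \<boxtimes> H) (v, u) (v', u') \<longleftrightarrow>
    (v = v' \<and> adj H u u') \<or> (adj G v v' \<and> u = u') \<or> (adj G v v' \<and> adj H u u')"
proof -
  have sG: "adj G x y \<Longrightarrow> adj G y x" for x y
    using simple_graph.adj_sym[OF assms(1)] by blast
  have sH: "adj H x y \<Longrightarrow> adj H y x" for x y
    using simple_graph.adj_sym[OF assms(2)] by blast
  show ?thesis (is "_ \<longleftrightarrow> ?R v u v' u'")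
  proof
    assume "adj (G \<boxtimes> H) (v, u) (v', u')"
    then have "{(v, u), (v', u')} \<in> edges (G \<boxtimes> H)"
      by (simp add: adj_def)
    then obtain a b a' b' where *: "{(v, u), (v', u')} = {(a, b), (a', b')}" "?R a b a' b'"
      unfolding strong_product_def graph.simps mem_Collect_eq by blast
    from *(1) consider "v = a" "u = b" "v' = a'" "u' = b'" | "v = a'" "u = b'" "v' = a" "u' = b"
      by (auto simp: doubleton_eq_iff)
    then show "?R v u v' u'"
      using *(2) sG sH by cases auto
  next
    assume "?R v u v' u'"
    moreover have "(v, u) \<in> verts G \<times> verts H" "(v', u') \<in> verts G \<times> verts H"
      using assms(3,4) by (simp_all add: strong_product_def)
    ultimately have "{(v, u), (v', u')} \<in> edges (G \<boxtimes> H)"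
      unfolding strong_product_def graph.simps mem_Collect_eq by blast
    then show "adj (G \<boxtimes> H) (v, u) (v', u')"
      by (simp add: adj_def)
  qed
qed

lemma simple_graph_strong_product:
  assumes "simple_graph G" "simple_graph H"
  shows "simple_graph (G \<boxtimes> H)"
proof
  show "finite (verts (G \<boxtimes> H))"
    using assms by (simp add: strong_product_def simple_graph.finite_verts)
next
  fix e assume "e \<in> edges (G \<boxtimes> H)"
  then obtain v u v' u' where e: "e = {(v, u), (v', u')}"
    and V: "(v, u) \<in> verts G \<times> verts H" "(v', u') \<in> verts G \<times> verts H"
    and a: "(v = v' \<and> adj H u u') \<or> (adj G v v' \<and> u = u') \<or> (adj G v v' \<and> adj H u u')"
    by (auto simp: strong_product_def)
  have "(v, u) \<noteq> (v', u')"
    using a simple_graph.adj_irrefl[OF assms(1)] simple_graph.adj_irrefl[OF assms(2)] by auto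
  then show "e \<subseteq> verts (G \<boxtimes> H) \<and> card e = 2"
    using e V by (simp add: strong_product_def)
qed

context simple_graph
begin

lemma domination_number_attained:
  "\<exists>D. dominating_set G D \<and> card D = domination_number G"
proof -
  have "\<exists>D. dominating_set G D \<and> card D = card (verts G)"
    by (rule exI[of _ "verts G"]) (auto simp: dominating_set_def)
  then show ?thesis
    unfolding domination_number_def by (rule LeastI)
qed

lemma domination_number_le: "dominating_set G D \<Longrightarrow> domination_number G \<le> card D"
  unfolding domination_number_def by (rule Least_le) blast

lemma simple_graph_delete_edges: "simple_graph (delete_edges G F)"
  using finite_verts edges_wf by unfold_locales (auto simp: delete_edges_def)

lemma bondage_number_attained:
  assumes "edges G \<noteq> {}"
  shows "\<exists>F. F \<subseteq> edges G \<and> card F = bondage_number G \<and>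
    domination_number (delete_edges G F) > domination_number G"
proof -
  interpret E: simple_graph "delete_edges G (edges G)"
    by (rule simple_graph_delete_edges)
  obtain D where D: "dominating_set (delete_edges G (edges G)) D"
    and cD: "card D = domination_number (delete_edges G (edges G))"
    using E.domination_number_attained by blast
  have "D = verts G"
    using D by (auto simp: dominating_set_def delete_edges_def adj_def)
  obtain e where "e \<in> edges G" using assms by blast
  then obtain u v where uv: "u \<noteq> v" "{u, v} \<in> edges G"
    using edges_wf by (metis card_2_iff)
  then have V: "u \<in> verts G" "v \<in> verts G" using edges_wf by blast+
  have "dominating_set G (verts G - {u})"
    using uv V by (auto simp: dominating_set_def adj_def)
  then have "domination_number G \<le> card (verts G - {u})"
    by (rule domination_number_le)
  also have "\<dots> < card (verts G)"
    using V(1) finite_verts by (rule card_Diff1_less[rotated])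
  finally have "domination_number (delete_edges G (edges G)) > domination_number G"
    using cD \<open>D = verts G\<close> by simp
  then have "\<exists>F. F \<subseteq> edges G \<and> card F = card (edges G) \<and>
      domination_number (delete_edges G F) > domination_number G"
    by blast
  then show ?thesis
    unfolding bondage_number_def by (rule LeastI)
qed

end

end

theory Submission
  imports Defs
begin

text \<open>
  The upper bound is an instance of the Hartnell--Rall inequality
  \<open>b(G) \<le> deg u + deg v - 1 - |N(u) \<inter> N(v)|\<close> for adjacent vertices \<open>u\<close>, \<open>v\<close>
  (\<open>bondage_number_adjacent_bound\<close>): a corner of the grid has three neighbours, the vertex next to
  it on the border has five, and the two have two common neighbours, which gives \<open>3 + 5 - 1 - 2 = 5\<close>.

  For the lower bound, no single edge may be critical. Call a set of vertices with pairwise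
  disjoint closed neighbourhoods a packing; every dominating set is at least as large as
  every packing. In the path on \<open>3 t + 1\<close> vertices the multiples of \<open>3\<close> are both dominating and a
  packing, and both properties pass to products of sets, so \<open>(t + 1) (r + 1)\<close> is the domination
  number of the grid. The point of the residue \<open>1\<close> is that for \<open>t \<ge> 1\<close> the path also has a
  second minimum dominating set, disjoint from the first. So every vertex of either path is avoided by a minimum
  dominating set. Given an edge between \<open>(a, b)\<close> and \<open>(a', b')\<close>, take minimum dominating sets \<open>A\<close>
  avoiding \<open>a\<close> and \<open>B\<close> avoiding \<open>b'\<close>. Then \<open>A \<times> B\<close> contains neither end of the edge, hence it
  remains dominating when the edge is deleted.
\<close>

section \<open>The Hartnell--Rall inequality\<close>

lemma adj_delete_edges: "adj (delete_edges G F) u v \<longleftrightarrow> adj G u v \<and> {u, v} \<notin> F"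
  by (simp add: adj_def delete_edges_def)

text \<open>
  Delete all edges at \<open>u\<close>, and those edges at \<open>v\<close> that do not lead to a neighbour of \<open>u\<close>.
  A dominating set of the remaining graph must contain the isolated vertex \<open>u\<close>, and it contains
  \<open>v\<close> or a common neighbour of \<open>u\<close> and \<open>v\<close>. In the original graph that second vertex dominates
  \<open>u\<close>, so that \<open>u\<close> can be dropped.
\<close>

theorem (in simple_graph) bondage_number_adjacent_bound:
  assumes uv: "adj G u v"
  shows "bondage_number G + card ({w. adj G u w} \<inter> {w. adj G v w}) + 1
    \<le> card {w. adj G u w} + card {w. adj G v w}"
proof -
  define N where "N x = {w. adj G x w}" for x
  define F where "F = (\<lambda>w. {u, w}) ` N u \<union> (\<lambda>w. {v, w}) ` (N v - N u - {u})"
  have fin: "finite (N x)" for x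
    by (rule finite_subset[OF _ finite_verts]) (auto simp: N_def dest: adj_verts)
  have sub: "F \<subseteq> edges G"
    by (auto simp: F_def N_def adj_def)
  interpret H: simple_graph "delete_edges G F"
    by (rule simple_graph_delete_edges)
  obtain D where D: "dominating_set (delete_edges G F) D"
    and cD: "card D = domination_number (delete_edges G F)"
    using H.domination_number_attained by blast
  have DV: "D \<subseteq> verts G"
    using D by (simp add: dominating_set_def delete_edges_def)
  have dom: "x \<in> D \<or> (\<exists>y\<in>D. adj G x y \<and> {x, y} \<notin> F)" if "x \<in> verts G" for x
    using D that by (simp add: dominating_set_def adj_delete_edges) (simp add: delete_edges_def)
  have iso: "{u, w} \<in> F" if "adj G u w" for w
    using that by (simp add: F_def N_def)
  have V: "u \<in> verts G" "v \<in> verts G"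
    using adj_verts[OF uv] by auto
  have uD: "u \<in> D"
    using dom[OF V(1)] iso by blast
  have "u \<noteq> v"
    using uv adj_irrefl by blast
  have "\<exists>w\<in>D. adj G u w"
  proof (cases "v \<in> D")
    case True
    then show ?thesis using uv by blast
  next
    case False
    then obtain w where w: "w \<in> D" "adj G v w" "{v, w} \<notin> F"
      using dom[OF V(2)] by blast
    have "w \<noteq> u"
      using w(3) iso[OF uv] by (metis insert_commute)
    then have "w \<in> N u"
      using w by (auto simp: F_def N_def)
    then show ?thesis using w(1) by (auto simp: N_def)
  qed
  then obtain w where w: "w \<in> D" "adj G u w" by blast
  then have "w \<noteq> u" using adj_irrefl by blast
  have "dominating_set G (D - {u})"
    unfolding dominating_set_def
  proof (intro conjI ballI)
    show "D - {u} \<subseteq> verts G" using DV by blast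
    fix x assume x: "x \<in> verts G"
    show "x \<in> D - {u} \<or> (\<exists>y\<in>D - {u}. adj G x y)"
    proof (cases "x = u")
      case True
      then show ?thesis using w \<open>w \<noteq> u\<close> by blast
    next
      case False
      have "y \<noteq> u" if "adj G x y" "{x, y} \<notin> F" for y
        using that iso[of x] adj_sym[of x u] by (metis insert_commute)
      then show ?thesis using dom[OF x] False by blast
    qed
  qed
  then have "domination_number G \<le> card (D - {u})"
    by (rule domination_number_le)
  also have "\<dots> < card D"
    using uD DV finite_verts by (meson card_Diff1_less finite_subset)
  finally have "domination_number G < domination_number (delete_edges G F)"
    using cD by simp
  then have "bondage_number G \<le> card F"
    unfolding bondage_number_def using sub by (intro Least_le) blast
  also have "card F \<le> card (N u) + card (N v - N u - {u})"
    unfolding F_def using fin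
    by (intro order.trans[OF card_Un_le] add_mono card_image_le) auto
  finally have b: "bondage_number G \<le> card (N u) + card (N v - N u - {u})" .
  have "u \<in> N v - N u"
    using uv adj_sym adj_irrefl by (auto simp: N_def)
  then have "card (N v - N u) = Suc (card (N v - N u - {u}))"
    using fin by (intro card.remove) auto
  moreover have "card (N v) = card (N u \<inter> N v) + card (N v - N u)"
    using fin card_Int_Diff[of "N v" "N u"] by (simp add: Int_commute)
  ultimately show ?thesis
    using b by (simp add: N_def)
qed

section \<open>Packings and minimum dominating sets\<close>

text \<open>Equivalently, distinct elements of \<open>P\<close> have disjoint closed neighbourhoods.\<close>

definition packing :: "'a graph \<Rightarrow> 'a set \<Rightarrow> bool" where
  "packing G P \<longleftrightarrow> P \<subseteq> verts G \<and>
     (\<forall>p\<in>P. \<forall>q\<in>P. \<forall>w. (p = w \<or> adj G p w) \<and> (q = w \<or> adj G q w) \<longrightarrow> p = q)"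

text \<open>
  Choosing for every element of \<open>P\<close> an element of \<open>D\<close> that dominates it gives an injection.
\<close>

lemma (in simple_graph) card_packing_le_card_dominating_set:
  assumes P: "packing G P" and D: "dominating_set G D"
  shows "card P \<le> card D"
proof -
  have "\<forall>p\<in>P. \<exists>w\<in>D. p = w \<or> adj G p w"
    using P D unfolding packing_def dominating_set_def by blast
  then obtain f where f: "\<forall>p\<in>P. f p \<in> D \<and> (p = f p \<or> adj G p (f p))"
    by metis
  have "inj_on f P"
  proof (rule inj_onI)
    fix p q assume "p \<in> P" "q \<in> P" "f p = f q"
    then show "p = q"
      using f P unfolding packing_def by metis
  qed
  moreover have "finite D"
    using D finite_verts by (auto simp: dominating_set_def intro: finite_subset)
  ultimately show ?thesis
    using f by (intro card_inj_on_le[of f]) auto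
qed

lemma (in simple_graph) card_packing_le_domination_number:
  "packing G P \<Longrightarrow> card P \<le> domination_number G"
  using domination_number_attained card_packing_le_card_dominating_set by metis

lemma dominating_set_delete_edges:
  assumes "dominating_set G D" and "\<And>e. e \<in> F \<Longrightarrow> D \<inter> e = {}"
  shows "dominating_set (delete_edges G F) D"
  unfolding dominating_set_def adj_delete_edges
proof (intro conjI ballI)
  show "D \<subseteq> verts (delete_edges G F)"
    using assms(1) by (simp add: dominating_set_def delete_edges_def)
  fix x assume "x \<in> verts (delete_edges G F)"
  then have "x \<in> D \<or> (\<exists>y\<in>D. adj G x y)"
    using assms(1) by (simp add: dominating_set_def delete_edges_def)
  then show "x \<in> D \<or> (\<exists>y\<in>D. adj G x y \<and> {x, y} \<notin> F)"
    using assms(2) by blast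
qed

lemma (in simple_graph) two_le_bondage_number:
  assumes ne: "edges G \<noteq> {}"
    and avoid: "\<And>e. e \<in> edges G \<Longrightarrow>
      \<exists>D. dominating_set G D \<and> card D \<le> domination_number G \<and> D \<inter> e = {}"
  shows "2 \<le> bondage_number G"
proof (rule ccontr)
  assume small: "\<not> 2 \<le> bondage_number G"
  obtain F where F: "F \<subseteq> edges G" "card F = bondage_number G"
    and gt: "domination_number G < domination_number (delete_edges G F)"
    using bondage_number_attained[OF ne] by blast
  have "finite (edges G)"
    by (rule finite_subset[of _ "Pow (verts G)"]) (use edges_wf finite_verts in auto)
  then have "finite F" using F(1) by (rule finite_subset[rotated])
  moreover have "card F \<le> 1" using small F(2) by simp
  \<comment> \<open>If \<open>F\<close> is empty, an arbitrary edge still provides a suitable dominating set.\<close>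
  ultimately obtain e where e: "e \<in> edges G" "F \<subseteq> {e}"
    using F(1) ne by (metis card_le_Suc0_iff_eq One_nat_def ex_in_conv insertCI subset_iff)
  obtain D where D: "dominating_set G D" "card D \<le> domination_number G" "D \<inter> e = {}"
    using avoid[OF e(1)] by blast
  then have "dominating_set (delete_edges G F) D"
    using e(2) by (intro dominating_set_delete_edges) auto
  then have "domination_number (delete_edges G F) \<le> card D"
    by (rule simple_graph.domination_number_le[OF simple_graph_delete_edges])
  then show False using D(2) gt by simp
qed

section \<open>Strong products\<close>

lemma verts_strong_product [simp]: "verts (G \<boxtimes> H) = verts G \<times> verts H"
  by (simp add: strong_product_def)

lemma closed_adj_strong_product:
  assumes "simple_graph G" "simple_graph H"
    and "v \<in> verts G" "u \<in> verts H" "v' \<in> verts G" "u' \<in> verts H"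
  shows "(v, u) = (v', u') \<or> adj (G \<boxtimes> H) (v, u) (v', u') \<longleftrightarrow>
    (v = v' \<or> adj G v v') \<and> (u = u' \<or> adj H u u')"
  using adj_strong_product[OF assms(1,2)] assms(3-) by auto

lemma dominating_set_strong_product:
  assumes "simple_graph G" "simple_graph H"
    and A: "dominating_set G A" and B: "dominating_set H B"
  shows "dominating_set (G \<boxtimes> H) (A \<times> B)"
  unfolding dominating_set_def
proof (intro conjI ballI)
  have sub: "A \<subseteq> verts G" "B \<subseteq> verts H"
    using A B by (auto simp: dominating_set_def)
  then show "A \<times> B \<subseteq> verts (G \<boxtimes> H)" by auto
  fix x assume "x \<in> verts (G \<boxtimes> H)"
  then obtain v u where x: "x = (v, u)" "v \<in> verts G" "u \<in> verts H" by auto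
  obtain a where a: "a \<in> A" "v = a \<or> adj G v a"
    using A x(2) unfolding dominating_set_def by blast
  obtain b where b: "b \<in> B" "u = b \<or> adj H u b"
    using B x(3) unfolding dominating_set_def by blast
  have "(v, u) = (a, b) \<or> adj (G \<boxtimes> H) (v, u) (a, b)"
    using closed_adj_strong_product[OF assms(1,2) x(2,3), of a b] a b sub by blast
  then show "x \<in> A \<times> B \<or> (\<exists>y\<in>A \<times> B. adj (G \<boxtimes> H) x y)"
    using a(1) b(1) x(1) by blast
qed

lemma packing_strong_product:
  assumes G: "simple_graph G" and H: "simple_graph H"
    and P: "packing G P" and Q: "packing H Q"
  shows "packing (G \<boxtimes> H) (P \<times> Q)"
  unfolding packing_def
proof (intro conjI ballI allI impI)
  have sub: "P \<subseteq> verts G" "Q \<subseteq> verts H"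
    using P Q by (auto simp: packing_def)
  then show "P \<times> Q \<subseteq> verts (G \<boxtimes> H)" by auto
  fix x y z
  assume x: "x \<in> P \<times> Q" and y: "y \<in> P \<times> Q"
    and c: "(x = z \<or> adj (G \<boxtimes> H) x z) \<and> (y = z \<or> adj (G \<boxtimes> H) y z)"
  obtain p q p' q' v u where xyz: "x = (p, q)" "y = (p', q')" "z = (v, u)"
    by (metis surj_pair)
  have mem: "p \<in> P" "q \<in> Q" "p' \<in> P" "q' \<in> Q"
    using x y xyz by auto
  have "x \<in> verts (G \<boxtimes> H)" using x sub by auto
  then have "z \<in> verts (G \<boxtimes> H)"
    using c simple_graph.adj_verts[OF simple_graph_strong_product[OF G H]] by blast
  then have z: "v \<in> verts G" "u \<in> verts H" using xyz(3) by auto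
  have "(p = v \<or> adj G p v) \<and> (q = u \<or> adj H q u)"
    and "(p' = v \<or> adj G p' v) \<and> (q' = u \<or> adj H q' u)"
    using c mem sub z unfolding xyz
    by (metis closed_adj_strong_product[OF G H] subsetD)+
  then have "p = p'" "q = q'"
    using P Q mem unfolding packing_def by blast+
  then show "x = y" using xyz by simp
qed

text \<open>
  Excluding the first coordinate of one end of the edge and the second coordinate of the other end
  is enough to keep both ends out of a product of dominating sets.
\<close>

lemma two_le_bondage_number_strong_product:
  assumes G: "simple_graph G" and H: "simple_graph H"
    and P: "packing G P" and Q: "packing H Q"
    and avG: "\<And>a. a \<in> verts G \<Longrightarrow> \<exists>A. dominating_set G A \<and> card A \<le> card P \<and> a \<notin> A"
    and avH: "\<And>b. b \<in> verts H \<Longrightarrow> \<exists>B. dominating_set H B \<and> card B \<le> card Q \<and> b \<notin> B"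
    and ne: "edges (G \<boxtimes> H) \<noteq> {}"
  shows "2 \<le> bondage_number (G \<boxtimes> H)"
proof -
  interpret S: simple_graph "G \<boxtimes> H"
    by (rule simple_graph_strong_product[OF G H])
  show ?thesis
  proof (rule S.two_le_bondage_number[OF ne])
    fix e assume "e \<in> edges (G \<boxtimes> H)"
    then obtain a b a' b' where e: "e = {(a, b), (a', b')}"
      and V: "a \<in> verts G" "b' \<in> verts H"
      by (auto simp: strong_product_def)
    obtain A where A: "dominating_set G A" "card A \<le> card P" "a \<notin> A"
      using avG[OF V(1)] by blast
    obtain B where B: "dominating_set H B" "card B \<le> card Q" "b' \<notin> B"
      using avH[OF V(2)] by blast
    have "card (A \<times> B) \<le> card (P \<times> Q)"
      using A(2) B(2) by (simp add: card_cartesian_product mult_le_mono)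
    also have "\<dots> \<le> domination_number (G \<boxtimes> H)"
      by (intro S.card_packing_le_domination_number packing_strong_product G H P Q)
    finally show "\<exists>D. dominating_set (G \<boxtimes> H) D \<and> card D \<le> domination_number (G \<boxtimes> H) \<and> D \<inter> e = {}"
      using dominating_set_strong_product[OF G H A(1) B(1)] A(3) B(3) e by blast
  qed
qed

section \<open>Paths on \<open>3 t + 1\<close> vertices\<close>

lemma verts_path_graph [simp]: "verts (path_graph k) = {..<k}"
  by (simp add: path_graph_def)

lemma adj_path_graph:
  "adj (path_graph k) i j \<longleftrightarrow> i < k \<and> j < k \<and> (j = Suc i \<or> i = Suc j)"
  by (auto simp: adj_def path_graph_def doubleton_eq_iff)

lemma packing_multiples_of_3: "packing (path_graph (3 * t + 1)) ((\<lambda>i. 3 * i) ` {..t})"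
  unfolding packing_def adj_path_graph by auto

lemma card_multiples_of_3: "card ((\<lambda>i::nat. 3 * i) ` {..t}) = t + 1"
  by (subst card_image) (auto simp: inj_on_def)

lemma dominating_set_multiples_of_3:
  "dominating_set (path_graph (3 * t + 1)) ((\<lambda>i. 3 * i) ` {..t})"
  unfolding dominating_set_def adj_path_graph
proof (intro conjI ballI)
  fix x assume "x \<in> verts (path_graph (3 * t + 1))"
  then have x: "x \<le> 3 * t" by simp
  \<comment> \<open>The multiple of \<open>3\<close> nearest to \<open>x\<close>.\<close>
  define i where "i = (x + 1) div 3"
  have "i \<le> t" "x = 3 * i \<or> 3 * i = Suc x \<or> x = Suc (3 * i)"
    using x unfolding i_def by presburger+
  then show "x \<in> (\<lambda>i. 3 * i) ` {..t} \<or> (\<exists>y\<in>(\<lambda>i. 3 * i) ` {..t}.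
      x < 3 * t + 1 \<and> y < 3 * t + 1 \<and> (y = Suc x \<or> x = Suc y))"
    using x by auto
qed auto

text \<open>
  The centres of the consecutive blocks of three vertices, together with the vertex
  \<open>3 t - 1\<close>, which takes care of the last vertex \<open>3 t\<close>.
\<close>

lemma dominating_set_block_centres:
  assumes "t \<ge> 1"
  shows "dominating_set (path_graph (3 * t + 1)) (insert (3 * t - 1) ((\<lambda>i. 3 * i + 1) ` {..<t}))"
    (is "dominating_set _ ?B")
  unfolding dominating_set_def adj_path_graph
proof (intro conjI ballI)
  show "?B \<subseteq> verts (path_graph (3 * t + 1))" by auto
  fix x assume "x \<in> verts (path_graph (3 * t + 1))"
  then have x: "x < 3 * t + 1" by simp
  show "x \<in> ?B \<or> (\<exists>y\<in>?B. x < 3 * t + 1 \<and> y < 3 * t + 1 \<and> (y = Suc x \<or> x = Suc y))"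
  proof (cases "x = 3 * t")
    case True
    then show ?thesis using assms by auto
  next
    case False
    define i where "i = x div 3"
    have "i < t" "x = 3 * i \<or> x = 3 * i + 1 \<or> x = Suc (3 * i + 1)"
      using x False unfolding i_def by presburger+
    then have "3 * i + 1 \<in> ?B" "3 * i + 1 < 3 * t + 1"
      and "x = 3 * i + 1 \<or> 3 * i + 1 = Suc x \<or> x = Suc (3 * i + 1)"
      by auto
    then show ?thesis using x by metis
  qed
qed

text \<open>The two dominating sets above are disjoint, so at least one of them misses any given vertex.\<close>

lemma path_graph_dominating_set_avoiding_vertex:
  assumes t: "t \<ge> 1"
  shows "\<exists>A. dominating_set (path_graph (3 * t + 1)) A \<and>
    card A \<le> card ((\<lambda>i::nat. 3 * i) ` {..t}) \<and> a \<notin> A"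
proof (cases "3 dvd a")
  case True
  have "card (insert (3 * t - 1) ((\<lambda>i. 3 * i + 1) ` {..<t})) \<le> Suc (card ((\<lambda>i. 3 * i + 1) ` {..<t}))"
    by (simp add: card_insert_if)
  also have "\<dots> \<le> t + 1"
    using card_image_le[of "{..<t}" "\<lambda>i. 3 * i + 1"] by simp
  finally have "card (insert (3 * t - 1) ((\<lambda>i. 3 * i + 1) ` {..<t})) \<le> card ((\<lambda>i::nat. 3 * i) ` {..t})"
    unfolding card_multiples_of_3 .
  moreover have "a \<notin> insert (3 * t - 1) ((\<lambda>i. 3 * i + 1) ` {..<t})"
    using True t by auto presburger+
  ultimately show ?thesis
    using dominating_set_block_centres[OF t] by blast
next
  case False
  then have "a \<notin> (\<lambda>i. 3 * i) ` {..t}" by auto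
  then show ?thesis
    using dominating_set_multiples_of_3 by blast
qed

section \<open>The bondage number of the grid\<close>

lemma bondage_number_path_strong_product_le_5:
  assumes "n \<ge> 2" and "m \<ge> 3"
  shows "bondage_number (path_graph n \<boxtimes> path_graph m) \<le> 5"
proof -
  let ?G = "path_graph n \<boxtimes> path_graph m"
  interpret S: simple_graph ?G
    by (intro simple_graph_strong_product simple_graph_path_graph)
  have adj: "adj ?G (v, u) (v', u') \<longleftrightarrow> v' < n \<and> u' < m \<and>
      (v = v' \<and> (u' = Suc u \<or> u = Suc u') \<or> (v' = Suc v \<or> v = Suc v') \<and> u = u' \<or>
       (v' = Suc v \<or> v = Suc v') \<and> (u' = Suc u \<or> u = Suc u'))"
    if "v < n" "u < m" for v u v' u'
  proof (cases "v' < n \<and> u' < m")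
    case True
    then show ?thesis
      using adj_strong_product[OF simple_graph_path_graph simple_graph_path_graph,
          of v u n m v' u'] that
      by (auto simp: adj_path_graph)
  next
    case False
    then show ?thesis
      using S.adj_verts[of "(v, u)" "(v', u')"] by auto
  qed
  have N0: "{w. adj ?G (0, 0) w} = {(0, 1), (1, 0), (1, 1)}"
    using assms by (auto simp: adj)
  have N1: "{w. adj ?G (0, 1) w} = {(0, 0), (1, 0), (1, 1), (0, 2), (1, 2)}"
    using assms by (auto simp: adj)
  have "adj ?G (0, 0) (0, 1)"
    using assms by (simp add: adj)
  from S.bondage_number_adjacent_bound[OF this] show ?thesis
    unfolding N0 N1 by simp
qed

theorem theorem9:
  fixes n m t r :: nat
  assumes "n \<ge> 2" and "m \<ge> 2"
    and "n = 3 * t + 1" and "m = 3 * r + 1"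
  shows "2 \<le> bondage_number (path_graph n \<boxtimes> path_graph m)
    \<and> bondage_number (path_graph n \<boxtimes> path_graph m) \<le> 5"
proof
  have t: "t \<ge> 1" and r: "r \<ge> 1" using assms by auto
  have "{(0, 0), (0, 1)} \<in> edges (path_graph n \<boxtimes> path_graph m)"
    using assms(1,2) adj_strong_product[OF simple_graph_path_graph simple_graph_path_graph,
        of 0 0 n m 0 1]
    by (simp add: adj_path_graph flip: adj_def)
  then have ne: "edges (path_graph n \<boxtimes> path_graph m) \<noteq> {}" by blast
  show "2 \<le> bondage_number (path_graph n \<boxtimes> path_graph m)"
    using ne unfolding assms(3,4)
    by (intro two_le_bondage_number_strong_product[OF simple_graph_path_graph simple_graph_path_graph
          packing_multiples_of_3 packing_multiples_of_3]
        path_graph_dominating_set_avoiding_vertex t r)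
  show "bondage_number (path_graph n \<boxtimes> path_graph m) \<le> 5"
    using assms(1,4) r by (intro bondage_number_path_strong_product_le_5) auto
qed

end
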